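(* Let $d \in \mathbb{N}$ and let $A \subset \mathbb{R}^d$ be a finite, spherical set whose circumradius satisfies $\mathrm{cr}(A) > \mathrm{diam}(A)/\sqrt{2}$. Then $A$ is not diameter-Ramsey.
   Context: $\mathbb{N}$ denotes the positive integers and $\|\cdot\|$ the Euclidean norm. The diameter of a set $P \subset \mathbb{R}^d$ is $\mathrm{diam}(P) := \sup\{\|x-y\| : x,y \in P\}$. A finite set $A \subset \mathbb{R}^d$ is called spherical if it lies on some sphere in $\mathbb{R}^d$, i.e. if there are $c \in \mathbb{R}^d$ and $\rho \ge 0$ with $\|x-c\| = \rho$ for all $x \in A$. The circumradius $\mathrm{cr}(A)$ of a spherical set $A \subset \mathbb{R}^d$ is the radius of the smallest sphere containing $A$, i.e. the smallest such $\rho$ (containing means that all points of $A$ lie on the sphere itself). Two sets, possibly in Euclidean spaces of different dimensions, are congruent if there is a distance-preserving bijection between them. A finite set $A \subset \mathbb{R}^d$ is called diameter-Ramsey if for every $r \in \mathbb{N}$ there exist $n \in \mathbb{N}$ and a finite set $B \subset \mathbb{R}^n$ with $\mathrm{diam}(B) = \mathrm{diam}(A)$ such that whenever the points of $B$ are coloured with $r$ colours, there is a monochromatic set $A' \subset B$ (all points of $A'$ have the same colour) which is congruent to $A$. *)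

theory Defs
  imports "HOL-Analysis.Analysis"
begin

definition spherical :: "'a::metric_space set \<Rightarrow> bool" where
  "spherical A \<longleftrightarrow> (\<exists>c \<rho>. \<rho> \<ge> 0 \<and> A \<subseteq> sphere c \<rho>)"

definition circumradius :: "'a::metric_space set \<Rightarrow> real" where
  "circumradius A = (LEAST \<rho>. \<rho> \<ge> 0 \<and> (\<exists>c. A \<subseteq> sphere c \<rho>))"

text \<open>
  The dimension of the space containing the set \<open>B\<close> in the definition of diameter-Ramsey sets is
  existentially quantified, so it cannot be a type. There, the space of dimension \<open>n\<close> is the
  carrier of \<^const>\<open>Euclidean_space\<close>, that is, the sequences of reals vanishing from
  index \<open>n\<close> on. The topology is not used; the metric is the following one.
\<close>

definition edist :: "nat \<Rightarrow> (nat \<Rightarrow> real) \<Rightarrow> (nat \<Rightarrow> real) \<Rightarrow> real" where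
  "edist n x y = L2_set (\<lambda>i. x i - y i) {..<n}"

text \<open>As for \<^const>\<open>diameter\<close>, the empty set has diameter 0.\<close>

definition ediameter :: "nat \<Rightarrow> (nat \<Rightarrow> real) set \<Rightarrow> real" where
  "ediameter n S = (if S = {} then 0 else SUP (x, y)\<in>S \<times> S. edist n x y)"

definition congruent_wrt ::
  "('a \<Rightarrow> 'a \<Rightarrow> real) \<Rightarrow> 'a set \<Rightarrow> ('b \<Rightarrow> 'b \<Rightarrow> real) \<Rightarrow> 'b set \<Rightarrow> bool" where
  "congruent_wrt dS S dT T \<longleftrightarrow>
     (\<exists>f. bij_betw f S T \<and> (\<forall>x\<in>S. \<forall>y\<in>S. dT (f x) (f y) = dS x y))"

definition diameter_Ramsey :: "'a::metric_space set \<Rightarrow> bool" where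
  "diameter_Ramsey A \<longleftrightarrow>
     (\<forall>r::nat. r \<ge> 1 \<longrightarrow>
       (\<exists>n::nat. n \<ge> 1 \<and>
         (\<exists>B. B \<subseteq> topspace (Euclidean_space n) \<and> finite B \<and> ediameter n B = diameter A \<and>
           (\<forall>col::(nat \<Rightarrow> real) \<Rightarrow> nat. col ` B \<subseteq> {..<r} \<longrightarrow>
             (\<exists>A'. A' \<subseteq> B \<and> (\<exists>k. \<forall>x\<in>A'. col x = k) \<and> congruent_wrt (edist n) A' dist A)))))"

end

theory Submission
  imports Defs
begin

text \<open>
  Let \<open>D\<close> be the diameter of \<open>A\<close>, and \<open>\<rho> > D / \<surd>2\<close> its circumradius. The centre of the smallest
  sphere through \<open>A\<close> is an affine combination \<open>\<Sum>a\<in>A. \<lambda> a *\<^sub>R a\<close>. Expanding squares shows that every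
  congruent copy of \<open>A\<close> satisfies \<open>\<Sum>a\<in>A. \<lambda> a * \<parallel>a' - c\<parallel>\<^sup>2 \<ge> \<rho>\<^sup>2\<close> for every point \<open>c\<close>, where \<open>a'\<close>
  is the point corresponding to \<open>a\<close>. On the other hand, by a weak form of Jung's theorem, a finite
  set \<open>B\<close> of diameter \<open>D\<close> lies, whatever the dimension, in a ball about some \<open>c\<close> whose squared radius
  is as close to \<open>D\<^sup>2 / 2\<close> as desired. Colour \<open>x \<in> B\<close> by \<open>\<lfloor>\<parallel>x - c\<parallel>\<^sup>2 / \<epsilon>\<rfloor>\<close>. On a monochromatic copy of
  \<open>A\<close> the weighted sum is at most \<open>\<parallel>a' - c\<parallel>\<^sup>2 + \<epsilon> * (\<Sum>a\<in>A. \<bar>\<lambda> a\<bar>)\<close>, which is below \<open>\<rho>\<^sup>2\<close> for small \<open>\<epsilon>\<close>.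
\<close>

section \<open>Squared distances and a weak form of Jung's theorem\<close>

lemma edist_power2: "(edist n x y)\<^sup>2 = (\<Sum>i<n. (x i - y i)\<^sup>2)"
  by (simp add: edist_def L2_set_def sum_nonneg)

lemma edist_nonneg: "0 \<le> edist n x y"
  by (simp add: edist_def)

lemma edist_le_ediameter:
  assumes "finite B" "x \<in> B" "y \<in> B"
  shows "edist n x y \<le> ediameter n B"
proof -
  have "bdd_above ((\<lambda>(x, y). edist n x y) ` (B \<times> B))"
    using assms(1) by (intro bdd_above_finite) auto
  from cSUP_upper[OF _ this, of "(x, y)"] show ?thesis
    using assms by (auto simp: ediameter_def)
qed

text \<open>Stewart's theorem for a point on the line through \<open>c\<close> and \<open>y\<close>;
  it holds in each coordinate separately.\<close>

lemma edist_power2_convex_comb: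
  "(edist n x (\<lambda>i. c i + t * (y i - c i)))\<^sup>2 =
     (1 - t) * (edist n x c)\<^sup>2 + t * (edist n x y)\<^sup>2 - t * (1 - t) * (edist n y c)\<^sup>2"
  unfolding edist_power2 sum_distrib_left sum.distrib[symmetric] sum_subtractf[symmetric]
  by (rule sum.cong) (auto simp: power2_eq_square algebra_simps)

text \<open>
  The centre is found by moving, in step \<open>k\<close>, towards a farthest point of \<open>B\<close> by the fraction
  \<open>1 / (k + 2)\<close> of its distance.
\<close>

lemma approximate_Jung:
  assumes "finite B" and D: "\<And>x y. x \<in> B \<Longrightarrow> y \<in> B \<Longrightarrow> edist n x y \<le> D"
  shows "\<exists>c. \<forall>x\<in>B. (edist n x c)\<^sup>2 \<le> D\<^sup>2 / 2 * (1 + 1 / real (Suc k))"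
proof (cases "B = {}")
  case False
  have D2: "(edist n x y)\<^sup>2 \<le> D\<^sup>2" if "x \<in> B" "y \<in> B" for x y
    using D[OF that] by (intro power_mono edist_nonneg)
  show ?thesis
  proof (induction k)
    case 0
    obtain b where "b \<in> B" using False by blast
    then show ?case using D2 by (intro exI[of _ b]) auto
  next
    case (Suc k)
    then obtain c where c: "\<And>x. x \<in> B \<Longrightarrow> (edist n x c)\<^sup>2 \<le> D\<^sup>2 / 2 * (1 + 1 / real (Suc k))"
      by blast
    define R where "R = Max ((\<lambda>x. (edist n x c)\<^sup>2) ` B)"
    have "R \<in> (\<lambda>x. (edist n x c)\<^sup>2) ` B"
      unfolding R_def using assms(1) False by (intro Max_in) auto
    then obtain y where y: "y \<in> B" "(edist n y c)\<^sup>2 = R" by auto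
    have R: "(edist n x c)\<^sup>2 \<le> R" if "x \<in> B" for x
      unfolding R_def using assms(1) that by (intro Max_ge) auto
    \<comment> \<open>This \<open>t\<close> minimises the bound \<open>(1 - t)\<^sup>2 * (D\<^sup>2
      / 2 * (1 + 1 / real (Suc k))) + t * D\<^sup>2\<close> reached below.\<close>
    define t where "t = 1 / real (k + 2)"
    have t: "0 \<le> t" "t \<le> 1" by (auto simp: t_def field_simps)
    have "(edist n x (\<lambda>i. c i + t * (y i - c i)))\<^sup>2 \<le> D\<^sup>2 / 2 * (1 + 1 / real (Suc (Suc k)))"
      if x: "x \<in> B" for x
    proof -
      \<comment> \<open>Since \<open>y\<close> is a farthest point, the subtracted term is exactly
        \<open>t * (1 - t) * R\<close>, which lowers the coefficient of \<open>R\<close> from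
        \<open>1 - t\<close> to its square.\<close>
      have "(edist n x (\<lambda>i. c i + t * (y i - c i)))\<^sup>2 \<le> (1 - t) * R + t * D\<^sup>2 - t * (1 - t) * R"
        unfolding edist_power2_convex_comb y(2)
        by (intro diff_right_mono add_mono mult_left_mono R D2 x y(1)) (use t in auto)
      also have "\<dots> = (1 - t)\<^sup>2 * R + t * D\<^sup>2"
        by (simp add: power2_eq_square algebra_simps)
      also have "\<dots> \<le> (1 - t)\<^sup>2 * (D\<^sup>2 / 2 * (1 + 1 / real (Suc k))) + t * D\<^sup>2"
        using c[OF y(1)] y(2) by (intro add_right_mono mult_left_mono) auto
      also have "\<dots> = D\<^sup>2 / 2 * (1 + 1 / real (Suc (Suc k)))"
      proof -
        have "1 - t = (real k + 1) / (real k + 2)" by (simp add: t_def field_simps)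
        moreover have "t = 1 / (real k + 2)" by (simp add: t_def)
        moreover have "1 + 1 / real (Suc k) = (real k + 2) / (real k + 1)"
          by (simp add: field_simps)
        moreover have "1 + 1 / real (Suc (Suc k)) = (real k + 3) / (real k + 2)"
          by (simp add: field_simps)
        moreover have "((r + 1) / (r + 2))\<^sup>2 * (D\<^sup>2 / 2 * ((r + 2) / (r + 1))) + 1 / (r + 2) * D\<^sup>2 =
            D\<^sup>2 / 2 * ((r + 3) / (r + 2))" if "r \<ge> 0" for r :: real
          using that by (simp add: divide_simps power2_eq_square) (simp add: algebra_simps)
        ultimately show ?thesis by simp
      qed
      finally show ?thesis .
    qed
    then show ?case by blast
  qed
qed auto

section \<open>Weighted sums of squared distances, with weights of any sign\<close>

text \<open>The variance identity for signed weights: expanding the square splits the double sum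
  into products of single sums.\<close>

lemma weighted_variance:
  fixes w u :: "'a \<Rightarrow> real"
  assumes "sum w A = 1"
  shows "2 * ((\<Sum>a\<in>A. w a * (u a)\<^sup>2) - (\<Sum>a\<in>A. w a * u a)\<^sup>2) =
    (\<Sum>a\<in>A. \<Sum>b\<in>A. w a * w b * (u a - u b)\<^sup>2)"
proof -
  have "(\<Sum>a\<in>A. \<Sum>b\<in>A. w a * w b * (u a - u b)\<^sup>2) =
     (\<Sum>a\<in>A. \<Sum>b\<in>A. (w a * (u a)\<^sup>2) * w b + w a * (w b * (u b)\<^sup>2) - 2 * ((w a * u a) * (w b * u b)))"
    by (intro sum.cong refl) (simp add: power2_eq_square algebra_simps)
  also have "\<dots> = (\<Sum>a\<in>A. w a * (u a)\<^sup>2) * sum w A + sum w A * (\<Sum>a\<in>A. w a * (u a)\<^sup>2)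
      - 2 * ((\<Sum>a\<in>A. w a * u a) * (\<Sum>a\<in>A. w a * u a))"
    by (simp only: sum.distrib sum_subtractf sum_distrib_left[symmetric] sum_distrib_right[symmetric])
  finally show ?thesis using assms by (simp add: power2_eq_square)
qed

text \<open>In each coordinate \<open>weighted_variance\<close> applies to
  \<open>g a i - c i\<close>; the squared mean that is dropped is nonnegative even if some weights
  are negative.\<close>

lemma weighted_edist_power2_le:
  assumes "sum w A = 1"
  shows "(\<Sum>a\<in>A. \<Sum>b\<in>A. w a * w b * (edist n (g a) (g b))\<^sup>2) \<le> 2 * (\<Sum>a\<in>A. w a * (edist n (g a) c)\<^sup>2)"
proof -
  have "(\<Sum>a\<in>A. \<Sum>b\<in>A. w a * w b * (edist n (g a) (g b))\<^sup>2) =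
      (\<Sum>a\<in>A. \<Sum>b\<in>A. \<Sum>i<n. w a * w b * ((g a i - c i) - (g b i - c i))\<^sup>2)"
    by (simp add: edist_power2 sum_distrib_left)
  also have "\<dots> = (\<Sum>a\<in>A. \<Sum>i<n. \<Sum>b\<in>A. w a * w b * ((g a i - c i) - (g b i - c i))\<^sup>2)"
    by (intro sum.cong refl sum.swap)
  also have "\<dots> = (\<Sum>i<n. \<Sum>a\<in>A. \<Sum>b\<in>A. w a * w b * ((g a i - c i) - (g b i - c i))\<^sup>2)"
    by (rule sum.swap)
  also have "\<dots> = (\<Sum>i<n. 2 * ((\<Sum>a\<in>A. w a * (g a i - c i)\<^sup>2) - (\<Sum>a\<in>A. w a * (g a i - c i))\<^sup>2))"
    by (intro sum.cong refl weighted_variance[OF assms, symmetric])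
  also have "\<dots> \<le> (\<Sum>i<n. 2 * (\<Sum>a\<in>A. w a * (g a i - c i)\<^sup>2))"
    by (intro sum_mono) simp
  also have "\<dots> = 2 * (\<Sum>a\<in>A. w a * (edist n (g a) c)\<^sup>2)"
    by (simp add: edist_power2 sum_distrib_left) (rule sum.swap)
  finally show ?thesis .
qed

lemma weighted_sum_diff_eq_0:
  fixes A :: "'a::real_vector set"
  assumes "sum w A = 1" "(\<Sum>a\<in>A. w a *\<^sub>R a) = p"
  shows "(\<Sum>a\<in>A. w a *\<^sub>R (a - p)) = 0"
  using assms by (simp add: scaleR_diff_right sum_subtractf flip: scaleR_sum_left)

text \<open>Deviations from \<open>p\<close> have weighted mean zero, so the mixed inner products
  cancel in the double sum.\<close>

lemma weighted_dist_power2_sphere: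
  fixes A :: "'a::real_inner set"
  assumes w: "sum w A = 1" and p: "(\<Sum>a\<in>A. w a *\<^sub>R a) = p" and A: "A \<subseteq> sphere p \<rho>"
  shows "(\<Sum>a\<in>A. \<Sum>b\<in>A. w a * w b * (dist a b)\<^sup>2) = 2 * \<rho>\<^sup>2"
proof -
  note s = weighted_sum_diff_eq_0[OF w p]
  have "(\<Sum>a\<in>A. \<Sum>b\<in>A. w a * w b * (dist a b)\<^sup>2) =
     (\<Sum>a\<in>A. \<Sum>b\<in>A. 2 * \<rho>\<^sup>2 * (w a * w b) - 2 * ((w a *\<^sub>R (a - p)) \<bullet> (w b *\<^sub>R (b - p))))"
  proof (intro sum.cong refl)
    fix a b assume "a \<in> A" "b \<in> A"
    then have "(a - p) \<bullet> (a - p) = \<rho>\<^sup>2" "(b - p) \<bullet> (b - p) = \<rho>\<^sup>2"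
      using A by (auto simp: dist_norm norm_minus_commute simp flip: power2_norm_eq_inner)
    moreover have "(dist a b)\<^sup>2 = (a - p) \<bullet> (a - p) + (b - p) \<bullet> (b - p) - 2 * ((a - p) \<bullet> (b - p))"
      by (simp add: dist_norm power2_norm_eq_inner inner_diff inner_commute)
    ultimately show "w a * w b * (dist a b)\<^sup>2 =
        2 * \<rho>\<^sup>2 * (w a * w b) - 2 * ((w a *\<^sub>R (a - p)) \<bullet> (w b *\<^sub>R (b - p)))"
      unfolding inner_scaleR_left inner_scaleR_right by algebra
  qed
  also have "\<dots> = 2 * \<rho>\<^sup>2 * (sum w A * sum w A)
      - 2 * ((\<Sum>a\<in>A. w a *\<^sub>R (a - p)) \<bullet> (\<Sum>b\<in>A. w b *\<^sub>R (b - p)))"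
    by (simp only: sum_subtractf sum_distrib_left[symmetric] sum_distrib_right[symmetric]
      inner_sum_left[symmetric] inner_sum_right[symmetric])
  finally show ?thesis by (simp add: w s)
qed

section \<open>The centre of the smallest sphere\<close>

text \<open>Any centre projects orthogonally to a point of the affine hull, which by Pythagoras is
  again equidistant from all of \<open>A\<close>.\<close>

lemma spherical_centre_in_affine_hull:
  fixes A :: "'a::euclidean_space set"
  assumes "spherical A" "A \<noteq> {}"
  obtains p \<rho> where "p \<in> affine hull A" "\<rho> \<ge> 0" "A \<subseteq> sphere p \<rho>"
proof -
  obtain c r where c: "A \<subseteq> sphere c r" using assms(1) by (auto simp: spherical_def)
  obtain a0 where a0: "a0 \<in> A" using assms(2) by blast
  let ?S = "(\<lambda>x. x - a0) ` A"
  obtain y z where y: "y \<in> span ?S" and z: "\<And>w. w \<in> span ?S \<Longrightarrow> orthogonal z w"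
    and yz: "c - a0 = y + z"
    using orthogonal_subspace_decomp_exists[of ?S "c - a0"] by metis
  have "affine hull A = (+) a0 ` span ?S"
    using affine_hull_span_gen[OF hull_inc[OF a0]] by simp
  with y have p: "a0 + y \<in> affine hull A" by blast
  have "(dist (a0 + y) a)\<^sup>2 = r\<^sup>2 - z \<bullet> z" if "a \<in> A" for a
  proof -
    define u where "u = a0 + y - a"
    have "u = y - (a - a0)" by (simp add: u_def)
    moreover have "a - a0 \<in> span ?S" using that by (intro span_base) auto
    ultimately have "orthogonal z u" using y by (metis z span_diff)
    moreover have "c - a = u + z" using yz by (simp add: u_def algebra_simps)
    moreover have "r\<^sup>2 = (c - a) \<bullet> (c - a)"
      using c that by (auto simp: dist_norm simp flip: power2_norm_eq_inner)
    moreover have "(dist (a0 + y) a)\<^sup>2 = u \<bullet> u"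
      by (simp add: dist_norm power2_norm_eq_inner u_def)
    ultimately show ?thesis
      by (simp add: orthogonal_def inner_add inner_commute)
  qed
  then have "dist (a0 + y) a = dist (a0 + y) a0" if "a \<in> A" for a
    using that a0 by (metis zero_le_dist power2_eq_iff_nonneg)
  then have "A \<subseteq> sphere (a0 + y) (dist (a0 + y) a0)" by auto
  with p that show ?thesis by (meson zero_le_dist)
qed

text \<open>Expanding about \<open>p\<close>, the linear term averages to zero, so a sphere through
  \<open>A\<close> with centre \<open>c\<close> has squared radius
  \<open>\<rho>\<^sup>2 + (p - c) \<bullet> (p - c)\<close>.\<close>

lemma circumradius_eq_affine:
  fixes A :: "'a::real_inner set"
  assumes w: "sum w A = 1" and p: "(\<Sum>a\<in>A. w a *\<^sub>R a) = p"
    and A: "A \<subseteq> sphere p \<rho>" and "\<rho> \<ge> 0"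
  shows "circumradius A = \<rho>"
  unfolding circumradius_def
proof (rule Least_equality)
  show "\<rho> \<ge> 0 \<and> (\<exists>c. A \<subseteq> sphere c \<rho>)" using assms by blast
next
  fix r assume "r \<ge> 0 \<and> (\<exists>c. A \<subseteq> sphere c r)"
  then obtain c where r: "r \<ge> 0" and c: "A \<subseteq> sphere c r" by blast
  note s = weighted_sum_diff_eq_0[OF w p]
  have "r\<^sup>2 = (\<Sum>a\<in>A. w a * r\<^sup>2)" using w by (simp flip: sum_distrib_right)
  also have "\<dots> = (\<Sum>a\<in>A. w a * (\<rho>\<^sup>2 + (p - c) \<bullet> (p - c)) + 2 * ((w a *\<^sub>R (a - p)) \<bullet> (p - c)))"
  proof (intro sum.cong refl)
    fix a assume "a \<in> A"
    then have "(a - p) \<bullet> (a - p) = \<rho>\<^sup>2" "(a - c) \<bullet> (a - c) = r\<^sup>2"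
      using A c by (auto simp: dist_norm norm_minus_commute simp flip: power2_norm_eq_inner)
    moreover have "(a - c) \<bullet> (a - c) = (a - p) \<bullet> (a - p) + (p - c) \<bullet> (p - c) + 2 * ((a - p) \<bullet> (p - c))"
      by (simp add: inner_diff inner_commute)
    ultimately show "w a * r\<^sup>2 =
        w a * (\<rho>\<^sup>2 + (p - c) \<bullet> (p - c)) + 2 * ((w a *\<^sub>R (a - p)) \<bullet> (p - c))"
      unfolding inner_scaleR_left by algebra
  qed
  also have "\<dots> = sum w A * (\<rho>\<^sup>2 + (p - c) \<bullet> (p - c)) + 2 * ((\<Sum>a\<in>A. w a *\<^sub>R (a - p)) \<bullet> (p - c))"
    by (simp only: sum.distrib sum_distrib_right sum_distrib_left inner_sum_left)
  finally have "r\<^sup>2 = \<rho>\<^sup>2 + (p - c) \<bullet> (p - c)" by (simp add: w s)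
  then have "\<rho>\<^sup>2 \<le> r\<^sup>2" by simp
  then show "\<rho> \<le> r" using r by (rule power2_le_imp_le)
qed

text \<open>The weights are affine coordinates of the centre. They depend on \<open>A\<close> alone,
  so the number of colours can be fixed before \<open>n\<close>, \<open>B\<close> and the copy
  \<open>g\<close> are known.\<close>

lemma congruent_wrt_weighted_sum_ge:
  fixes A :: "'a::euclidean_space set"
  assumes "finite A" "spherical A" "A \<noteq> {}"
  obtains w where "sum w A = 1"
    and "\<And>n g c. (\<And>a b. a \<in> A \<Longrightarrow> b \<in> A \<Longrightarrow> edist n (g a) (g b) = dist a b) \<Longrightarrow>
      (circumradius A)\<^sup>2 \<le> (\<Sum>a\<in>A. w a * (edist n (g a) c)\<^sup>2)"
proof -
  obtain p \<rho> where p: "p \<in> affine hull A" "\<rho> \<ge> 0" "A \<subseteq> sphere p \<rho>"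
    using spherical_centre_in_affine_hull assms(2,3) by blast
  obtain w where w: "sum w A = 1" "(\<Sum>a\<in>A. w a *\<^sub>R a) = p"
    using p(1) assms(1) by (auto simp: affine_hull_finite)
  show ?thesis
  proof (rule that[OF w(1)])
    fix n c and g :: "'a \<Rightarrow> nat \<Rightarrow> real"
    assume g: "\<And>a b. a \<in> A \<Longrightarrow> b \<in> A \<Longrightarrow> edist n (g a) (g b) = dist a b"
    have "2 * \<rho>\<^sup>2 = (\<Sum>a\<in>A. \<Sum>b\<in>A. w a * w b * (edist n (g a) (g b))\<^sup>2)"
      using weighted_dist_power2_sphere[OF w p(3)] by (simp add: g cong: sum.cong)
    also have "\<dots> \<le> 2 * (\<Sum>a\<in>A. w a * (edist n (g a) c)\<^sup>2)"
      by (rule weighted_edist_power2_le[OF w(1)])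
    finally show "(circumradius A)\<^sup>2 \<le> (\<Sum>a\<in>A. w a * (edist n (g a) c)\<^sup>2)"
      using circumradius_eq_affine[OF w p(3,2)] by simp
  qed
qed

section \<open>Colouring by squared distance from an approximate Jung centre\<close>

theorem theorem1p2:
  fixes A :: "(real ^ 'd::finite) set"
  assumes "finite A"
    and "spherical A"
    and "circumradius A > diameter A / sqrt 2"
  shows "\<not> diameter_Ramsey A"
proof
  assume Ramsey: "diameter_Ramsey A"
  define D where "D = diameter A"
  have D: "D \<ge> 0"
    unfolding D_def by (simp add: assms(1) diameter_ge_0 finite_imp_bounded)
  \<comment> \<open>Both \<open>circumradius {}\<close> and \<open>diameter {}\<close> are 0, which
    contradicts the strict inequality.\<close>
  have "A \<noteq> {}"
  proof
    assume "A = {}"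
    moreover have "circumradius ({} :: (real ^ 'd) set) = 0"
      unfolding circumradius_def by (rule Least_equality) auto
    ultimately show False using assms(3) by simp
  qed
  then obtain a0 where a0: "a0 \<in> A" by blast
  obtain w where w1: "sum w A = 1"
    and w: "\<And>n g c. (\<And>a b. a \<in> A \<Longrightarrow> b \<in> A \<Longrightarrow> edist n (g a) (g b) = dist a b) \<Longrightarrow>
      (circumradius A)\<^sup>2 \<le> (\<Sum>a\<in>A. w a * (edist n (g a) c)\<^sup>2)"
    using congruent_wrt_weighted_sum_ge[OF assms(1,2) \<open>A \<noteq> {}\<close>] by blast
  define L where "L = (\<Sum>a\<in>A. \<bar>w a\<bar>)"
  have L: "L \<ge> 0" by (simp add: L_def sum_nonneg)
  define \<eta> where "\<eta> = (circumradius A)\<^sup>2 - D\<^sup>2 / 2"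
  have "(D / sqrt 2)\<^sup>2 < (circumradius A)\<^sup>2"
    using assms(3) D by (intro power_strict_mono) (auto simp: D_def)
  then have \<eta>: "\<eta> > 0" by (simp add: \<eta>_def power_divide)
  \<comment> \<open>Half of the slack \<eta> is kept for the excess in Jung's bound, the other half
    for variation within a colour; \<open>L + 1\<close> makes
    \<open>\<epsilon> * L < \<eta> / 2\<close> strict.\<close>
  define \<epsilon> where "\<epsilon> = \<eta> / (2 * (L + 1))"
  have \<epsilon>: "\<epsilon> > 0" using \<eta> L by (simp add: \<epsilon>_def)
  have "\<epsilon> * (L + 1) = \<eta> / 2" using L by (simp add: \<epsilon>_def field_simps)
  then have \<epsilon>L: "\<epsilon> * L < \<eta> / 2" using \<epsilon> by (simp add: algebra_simps)
  define Q where "Q = D\<^sup>2 / 2 + \<eta> / 2"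
  \<comment> \<open>The colours run from 0 to the floor of \<open>Q / \<epsilon>\<close> inclusive,
    hence \<open>Suc\<close>.\<close>
  define r where "r = Suc (nat \<lfloor>Q / \<epsilon>\<rfloor>)"
  have "r \<ge> 1" by (simp add: r_def)
  with Ramsey obtain n B where B: "finite B" "ediameter n B = D"
    and mono: "\<And>col::(nat \<Rightarrow> real) \<Rightarrow> nat. col ` B \<subseteq> {..<r} \<Longrightarrow>
             \<exists>A'. A' \<subseteq> B \<and> (\<exists>k. \<forall>x\<in>A'. col x = k) \<and> congruent_wrt (edist n) A' dist A"
    unfolding diameter_Ramsey_def D_def by metis
  have "\<exists>k. D\<^sup>2 / 2 * (1 / real (Suc k)) < \<eta> / 2"
  proof -
    obtain k where "D\<^sup>2 / \<eta> < real k" using reals_Archimedean2 by blast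
    then have "D\<^sup>2 < \<eta> * real (Suc k)" using \<eta> by (simp add: field_simps)
    then show ?thesis by (intro exI[of _ k]) (simp add: field_simps)
  qed
  then obtain k where k: "D\<^sup>2 / 2 * (1 / real (Suc k)) < \<eta> / 2" by blast
  obtain c where c: "\<And>x. x \<in> B \<Longrightarrow> (edist n x c)\<^sup>2 \<le> D\<^sup>2 / 2 * (1 + 1 / real (Suc k))"
    using approximate_Jung[of B n D k] edist_le_ediameter[of B _ _ n] B by blast
  have cQ: "(edist n x c)\<^sup>2 \<le> Q" if "x \<in> B" for x
  proof -
    have "(edist n x c)\<^sup>2 \<le> D\<^sup>2 / 2 + D\<^sup>2 / 2 * (1 / real (Suc k))"
      using c[OF that] by (simp only: distrib_left mult_1_right)
    with k show ?thesis unfolding Q_def by linarith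
  qed
  define col where "col x = nat \<lfloor>(edist n x c)\<^sup>2 / \<epsilon>\<rfloor>" for x
  have "col ` B \<subseteq> {..<r}"
    using cQ \<epsilon> by (auto simp: col_def r_def less_Suc_eq_le intro!: nat_mono floor_mono divide_right_mono)
  from mono[OF this] obtain A' m f where A': "A' \<subseteq> B" "\<And>x. x \<in> A' \<Longrightarrow> col x = m"
    and f: "bij_betw f A' A" "\<And>x y. x \<in> A' \<Longrightarrow> y \<in> A' \<Longrightarrow> dist (f x) (f y) = edist n x y"
    unfolding congruent_wrt_def by blast
  define g where "g = inv_into A' f"
  have gA': "g a \<in> A'" and fg: "f (g a) = a" if "a \<in> A" for a
    using f(1) that unfolding g_def bij_betw_def by (auto simp: inv_into_into f_inv_into_f)
  have g: "edist n (g a) (g b) = dist a b" if "a \<in> A" "b \<in> A" for a b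
    using f(2)[of "g a" "g b"] gA' fg that by simp
  let ?q = "\<lambda>a. (edist n (g a) c)\<^sup>2"
  have near: "\<bar>?q a - ?q a0\<bar> \<le> \<epsilon>" if "a \<in> A" for a
  proof -
    have "nat \<lfloor>?q a / \<epsilon>\<rfloor> = nat \<lfloor>?q a0 / \<epsilon>\<rfloor>"
      using A'(2)[OF gA'[OF that]] A'(2)[OF gA'[OF a0]] by (simp add: col_def)
    \<comment> \<open>On nonnegative floors \<open>nat\<close> is injective.\<close>
    moreover have "?q a / \<epsilon> \<ge> 0" "?q a0 / \<epsilon> \<ge> 0" using \<epsilon> by auto
    ultimately have "\<lfloor>?q a / \<epsilon>\<rfloor> = \<lfloor>?q a0 / \<epsilon>\<rfloor>" by (metis eq_nat_nat_iff zero_le_floor)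
    then have "\<bar>?q a / \<epsilon> - ?q a0 / \<epsilon>\<bar> \<le> 1" by linarith
    then show ?thesis using \<epsilon> by (simp add: field_simps flip: diff_divide_distrib)
  qed
  have "(circumradius A)\<^sup>2 \<le> (\<Sum>a\<in>A. w a * ?q a)" using w g by blast
  \<comment> \<open>With negative weights possible, the bound \<open>Q\<close> on each
    \<open>?q a\<close> does not bound the sum, so every term is compared with the single value
    \<open>?q a0\<close>.\<close>
  also have "\<dots> = sum w A * ?q a0 + (\<Sum>a\<in>A. w a * (?q a - ?q a0))"
    by (simp add: sum_distrib_right right_diff_distrib sum_subtractf)
  also have "\<dots> \<le> Q + \<epsilon> * L"
  proof (rule add_mono)
    show "sum w A * ?q a0 \<le> Q" using w1 cQ A'(1) gA'[OF a0] by auto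
    have "w a * (?q a - ?q a0) \<le> \<epsilon> * \<bar>w a\<bar>" if "a \<in> A" for a
    proof -
      have "w a * (?q a - ?q a0) \<le> \<bar>w a\<bar> * \<bar>?q a - ?q a0\<bar>" by (metis abs_ge_self abs_mult)
      also have "\<dots> \<le> \<bar>w a\<bar> * \<epsilon>" by (intro mult_left_mono near that) auto
      finally show ?thesis by (simp add: mult.commute)
    qed
    then show "(\<Sum>a\<in>A. w a * (?q a - ?q a0)) \<le> \<epsilon> * L"
      unfolding L_def sum_distrib_left by (rule sum_mono)
  qed
  finally show False using \<epsilon>L unfolding Q_def \<eta>_def by argo
qed

end
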